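(* If $\mu\in\mathrm{VConv}(\mathbb{R}^n)$ vanishes on all convex polynomials (i.e. on all convex polynomial functions $\mathbb{R}^n\to\mathbb{R}$), then $\mu=0$.
   Context: $\mathrm{Conv}(\mathbb{R}^n,\mathbb{R})$ is the space of finite-valued convex functions $\mathbb{R}^n\to\mathbb{R}$ with the topology of uniform convergence on compact subsets. A map $\mu:\mathrm{Conv}(\mathbb{R}^n,\mathbb{R})\to\mathbb{R}$ is a valuation if $\mu(f)+\mu(h)=\mu(f\vee h)+\mu(f\wedge h)$ whenever $f,h$ and the pointwise maximum $f\vee h$ and minimum $f\wedge h$ belong to $\mathrm{Conv}(\mathbb{R}^n,\mathbb{R})$. It is dually epi-translation invariant if $\mu(f+\ell)=\mu(f)$ for all $f$ and all affine $\ell:\mathbb{R}^n\to\mathbb{R}$. $\mathrm{VConv}(\mathbb{R}^n)$ is the space of all continuous, dually epi-translation invariant valuations on $\mathrm{Conv}(\mathbb{R}^n,\mathbb{R})$. *)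

theory Defs
  imports "HOL-Analysis.Analysis"
begin

definition Conv :: "((real ^ 'n) \<Rightarrow> real) set" where
  "Conv = {f. convex_on UNIV f}"

text \<open>Functions that are uniformly \<open>e\<close>-close to \<open>f\<close> on \<open>K\<close>; for \<open>K\<close> compact and \<open>e > 0\<close> these
  form a neighbourhood base at \<open>f\<close> of the topology of uniform convergence on compact subsets.\<close>

definition Conv_nbhd :: "(real ^ 'n) set \<Rightarrow> real \<Rightarrow> ((real ^ 'n) \<Rightarrow> real) \<Rightarrow> ((real ^ 'n) \<Rightarrow> real) set" where
  "Conv_nbhd K e f = {g \<in> Conv. \<forall>x\<in>K. dist (g x) (f x) < e}"

definition Conv_topology :: "((real ^ 'n) \<Rightarrow> real) topology" where
  "Conv_topology = topology (\<lambda>U. U \<subseteq> Conv \<and>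
     (\<forall>f\<in>U. \<exists>K e. compact K \<and> 0 < e \<and> Conv_nbhd K e f \<subseteq> U))"

lemma openin_Conv_topology:
  fixes U :: "((real ^ 'n) \<Rightarrow> real) set"
  shows "openin Conv_topology U \<longleftrightarrow>
     U \<subseteq> Conv \<and> (\<forall>f\<in>U. \<exists>K e. compact K \<and> 0 < e \<and> Conv_nbhd K e f \<subseteq> U)"
proof -
  have "istopology (\<lambda>U :: ((real ^ 'n) \<Rightarrow> real) set. U \<subseteq> Conv \<and>
     (\<forall>f\<in>U. \<exists>K e. compact K \<and> 0 < e \<and> Conv_nbhd K e f \<subseteq> U))" (is "istopology ?P")
    unfolding istopology_def
  proof (intro conjI allI impI)
    fix S T :: "((real ^ 'n) \<Rightarrow> real) set"
    assume S: "?P S" and T: "?P T"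
    then show "S \<inter> T \<subseteq> Conv" by blast
    show "\<forall>f\<in>S \<inter> T. \<exists>K e. compact K \<and> 0 < e \<and> Conv_nbhd K e f \<subseteq> S \<inter> T"
    proof
      fix f assume "f \<in> S \<inter> T"
      with S T obtain K e K' e' where K: "compact K" "0 < e" "Conv_nbhd K e f \<subseteq> S"
        and K': "compact K'" "0 < e'" "Conv_nbhd K' e' f \<subseteq> T"
        by (meson IntD1 IntD2)
      have "Conv_nbhd (K \<union> K') (min e e') f \<subseteq> Conv_nbhd K e f \<inter> Conv_nbhd K' e' f"
        by (auto simp: Conv_nbhd_def)
      with K K' have "compact (K \<union> K') \<and> 0 < min e e' \<and> Conv_nbhd (K \<union> K') (min e e') f \<subseteq> S \<inter> T"
        by auto
      then show "\<exists>K e. compact K \<and> 0 < e \<and> Conv_nbhd K e f \<subseteq> S \<inter> T" by blast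
    qed
  next
    fix \<K> :: "((real ^ 'n) \<Rightarrow> real) set set"
    assume *: "\<forall>S\<in>\<K>. ?P S"
    then show "\<Union>\<K> \<subseteq> Conv" by blast
    show "\<forall>f\<in>\<Union>\<K>. \<exists>K e. compact K \<and> 0 < e \<and> Conv_nbhd K e f \<subseteq> \<Union>\<K>"
      using * by (meson UnionE Union_upper subset_trans)
  qed
  then show ?thesis
    unfolding Conv_topology_def by (simp only: topology_inverse')
qed

lemma topspace_Conv_topology [simp]: "topspace Conv_topology = (Conv :: ((real ^ 'n) \<Rightarrow> real) set)"
proof -
  have "openin Conv_topology (Conv :: ((real ^ 'n) \<Rightarrow> real) set)"
    unfolding openin_Conv_topology
    by (auto simp: Conv_nbhd_def intro!: exI[of _ "{}"] exI[of _ "1::real"])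
  then show ?thesis
    by (metis openin_Conv_topology openin_subset openin_topspace subset_antisym)
qed

text \<open>Convergence in the topology is uniform convergence on every compact set.\<close>

lemma limitin_Conv_topology:
  fixes f :: "(real ^ 'n) \<Rightarrow> real"
  shows "limitin Conv_topology F f A \<longleftrightarrow>
     f \<in> Conv \<and> (\<forall>\<^sub>F i in A. F i \<in> Conv) \<and> (\<forall>K. compact K \<longrightarrow> uniform_limit K F f A)"
  (is "?L \<longleftrightarrow> ?R")
proof
  assume L: ?L
  then have f: "f \<in> Conv" by (simp add: limitin_def)
  have "openin Conv_topology (Conv :: ((real ^ 'n) \<Rightarrow> real) set)"
    using openin_topspace[of "Conv_topology :: ((real ^ 'n) \<Rightarrow> real) topology"] by simp
  with L f have ev: "\<forall>\<^sub>F i in A. F i \<in> Conv"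
    unfolding limitin_def by blast
  have "uniform_limit K F f A" if K: "compact K" for K
  proof (rule uniform_limitI)
    fix e :: real assume e: "0 < e"
    let ?U = "{g \<in> Conv. \<exists>d<e. \<forall>x\<in>K. dist (g x) (f x) < d}"
    have "openin Conv_topology ?U"
      unfolding openin_Conv_topology
    proof (intro conjI ballI)
      show "?U \<subseteq> Conv" by blast
      fix g assume "g \<in> ?U"
      then obtain d where d: "d < e" "\<And>x. x \<in> K \<Longrightarrow> dist (g x) (f x) < d" by blast
      have "Conv_nbhd K ((e - d) / 2) g \<subseteq> ?U"
      proof
        fix h assume h: "h \<in> Conv_nbhd K ((e - d) / 2) g"
        have "dist (h x) (f x) < (e + d) / 2" if "x \<in> K" for x
        proof -
          have "dist (h x) (g x) < (e - d) / 2" using h that by (simp add: Conv_nbhd_def)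
          moreover have "dist (h x) (f x) \<le> dist (h x) (g x) + dist (g x) (f x)"
            by (rule dist_triangle)
          ultimately show ?thesis using d(2)[OF that] by argo
        qed
        moreover have "(e + d) / 2 < e" using d(1) by simp
        moreover have "h \<in> Conv" using h by (simp add: Conv_nbhd_def)
        ultimately show "h \<in> ?U" by blast
      qed
      with K d(1) show "\<exists>K e. compact K \<and> 0 < e \<and> Conv_nbhd K e g \<subseteq> ?U"
        by (intro exI[of _ K] exI[of _ "(e - d) / 2"]) simp
    qed
    moreover have "f \<in> ?U" using f e by (auto intro!: exI[of _ "e / 2"])
    ultimately have "\<forall>\<^sub>F i in A. F i \<in> ?U"
      using L unfolding limitin_def by blast
    then show "\<forall>\<^sub>F i in A. \<forall>x\<in>K. dist (F i x) (f x) < e"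
      by (rule eventually_mono) (auto intro: less_trans)
  qed
  with f ev show ?R by blast
next
  assume R: ?R
  show ?L
    unfolding limitin_def
  proof (intro conjI allI impI)
    show "f \<in> topspace Conv_topology" using R by simp
    fix U assume "openin Conv_topology U \<and> f \<in> U"
    then obtain K e where K: "compact K" "0 < e" "Conv_nbhd K e f \<subseteq> U"
      by (auto simp: openin_Conv_topology)
    have "\<forall>\<^sub>F i in A. \<forall>x\<in>K. dist (F i x) (f x) < e"
      using R K by (blast intro: uniform_limitD)
    moreover have "\<forall>\<^sub>F i in A. F i \<in> Conv" using R by blast
    ultimately show "\<forall>\<^sub>F i in A. F i \<in> U"
      by eventually_elim (use K in \<open>auto simp: Conv_nbhd_def\<close>)
  qed
qed

text \<open>Functionals on \<open>Conv\<close> are represented by total functions, whose values outside \<open>Conv\<close> are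
  irrelevant.\<close>

definition is_valuation :: "(((real ^ 'n) \<Rightarrow> real) \<Rightarrow> real) \<Rightarrow> bool" where
  "is_valuation \<mu> \<longleftrightarrow>
     (\<forall>f\<in>Conv. \<forall>h\<in>Conv. (\<lambda>x. max (f x) (h x)) \<in> Conv \<longrightarrow> (\<lambda>x. min (f x) (h x)) \<in> Conv \<longrightarrow>
        \<mu> f + \<mu> h = \<mu> (\<lambda>x. max (f x) (h x)) + \<mu> (\<lambda>x. min (f x) (h x)))"

definition dually_epi_translation_invariant :: "(((real ^ 'n) \<Rightarrow> real) \<Rightarrow> real) \<Rightarrow> bool" where
  "dually_epi_translation_invariant \<mu> \<longleftrightarrow>
     (\<forall>f\<in>Conv. \<forall>l c. linear l \<longrightarrow> \<mu> (\<lambda>x. f x + (l x + c)) = \<mu> f)"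

definition VConv :: "(((real ^ 'n) \<Rightarrow> real) \<Rightarrow> real) set" where
  "VConv = {\<mu>. continuous_map Conv_topology euclideanreal \<mu> \<and> is_valuation \<mu> \<and>
     dually_epi_translation_invariant \<mu>}"

end

theory Submission
  imports Defs
begin

text \<open>Convex polynomials are dense among the finite convex functions, so a continuous functional that
  vanishes on them vanishes identically. For the density, \<open>f\<close> is close on a ball to a maximum of
  finitely many affine functions, hence, after an affine normalization with values \<open>w i\<close> in \<open>(0, 1]\<close>,
  to an \<open>\<ell>\<^sup>M\<close>-norm \<open>g powr (1 / M)\<close> with \<open>g = \<Sum>i. w i ^ M\<close>. Replacing \<open>t powr (1 / M)\<close> by a truncation
  \<open>S\<close> of its binomial series at \<open>1\<close> gives the polynomial \<open>S \<circ> g\<close>, which is still convex on the ball: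
  \<open>S\<close> satisfies exactly the inequality \<open>t S'' + (1 - 1 / M) S' \<ge> 0\<close> that \<open>t powr (1 / M)\<close> satisfies with
  equality, and together with \<open>(1 - 1 / M) g'\<^sup>2 \<le> g g''\<close> along lines (Cauchy-Schwarz) this is all that
  convexity needs, as \<open>S' \<ge> 0\<close>. Since second derivatives of polynomials grow polynomially, adding
  \<open>e (|x|\<^sup>2 / R\<^sup>2) ^ m\<close> with \<open>m\<close> large then makes a polynomial that is convex on the ball of radius
  \<open>2 R\<close> convex everywhere, and changes it by at most \<open>e\<close> on the ball of radius \<open>R\<close>.\<close>

section \<open>Truncated binomial series of a root\<close>

text \<open>In the variable \<open>s = 1 - t\<close> every coefficient of
  \<open>(1 - s) powr \<alpha>\<close> after the constant one is nonpositive. This gives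
  \<open>S' \<ge> 0\<close>, leaves one term of the right sign in the differential inequality, and
  makes the truncation error increase with \<open>s\<close>, so that on \<open>[a, 1]\<close> it is
  largest at \<open>t = a\<close>.\<close>

lemma truncated_binomial_series_root:
  fixes \<alpha> a e :: real
  assumes \<alpha>: "0 < \<alpha>" "\<alpha> \<le> 1" and a: "0 < a" "a \<le> 1" and e: "0 < e"
  obtains S S' S'' :: "real \<Rightarrow> real" where
    "real_polynomial_function S"
    "\<And>t. (S has_real_derivative S' t) (at t)"
    "\<And>t. (S' has_real_derivative S'' t) (at t)"
    "\<And>t. t \<le> 1 \<Longrightarrow> 0 \<le> S' t"
    "\<And>t. t \<le> 1 \<Longrightarrow> 0 \<le> t * S'' t + (1 - \<alpha>) * S' t"
    "\<And>t. a \<le> t \<Longrightarrow> t \<le> 1 \<Longrightarrow> \<bar>S t - t powr \<alpha>\<bar> \<le> e"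
proof -
  define c where "c j = (\<alpha> gchoose j) * (- 1) ^ j" for j
  define d where "d j = real (Suc j) * c (Suc j)" for j
  have c_Suc: "d j = (real j - \<alpha>) * c j" for j
  proof -
    have "real (Suc j) * (\<alpha> gchoose Suc j) = (\<alpha> - real j) * (\<alpha> gchoose j)"
      using gbinomial_mult_1[of \<alpha> j] by (simp add: algebra_simps)
    then show ?thesis
      unfolding c_def d_def by (simp add: mult.assoc[symmetric] left_diff_distrib)
  qed
  have d_Suc: "real (Suc j) * d (Suc j) = (real (Suc j) - \<alpha>) * d j" for j
    using c_Suc[of "Suc j"] by (simp add: d_def)
  \<comment> \<open>The sign of \<open>d 0 = - \<alpha>\<close> propagates: the factor
    \<open>real (Suc j) - \<alpha>\<close> in \<open>d_Suc\<close> is nonnegative because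
    \<open>\<alpha> \<le> 1\<close>.\<close>
  have d_nonpos: "d j \<le> 0" for j
  proof (induction j)
    case 0
    then show ?case using \<alpha> by (simp add: c_Suc c_def)
  next
    case (Suc j)
    have "real (Suc j) * d (Suc j) \<le> 0"
      unfolding d_Suc using \<alpha> Suc by (intro mult_nonneg_nonpos) auto
    then show ?case by (simp add: mult_le_0_iff)
  qed
  have c_nonpos: "c (Suc j) \<le> 0" for j
    using d_nonpos[of j] by (simp add: d_def mult_le_0_iff)
  \<comment> \<open>With \<open>Suc K\<close> terms in \<open>T K\<close>, the derivative
    \<open>T' K\<close> has exactly \<open>K\<close>. The exponent \<open>j - 1\<close> at
    \<open>j = 0\<close> is harmless because of the factor \<open>real j\<close>.\<close>
  define T where "T K s = (\<Sum>j<Suc K. c j * s ^ j)" for K and s :: real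
  define T' where "T' K s = (\<Sum>j<K. d j * s ^ j)" for K and s :: real
  define T'' where "T'' K s = (\<Sum>j<K. d j * (real j * s ^ (j - 1)))" for K and s :: real
  have T: "(T K has_real_derivative T' K s) (at s)" for K s
  proof -
    have "(T K has_real_derivative (\<Sum>j<Suc K. c j * (real j * s ^ (j - 1)))) (at s)"
      unfolding T_def by (auto intro!: derivative_eq_intros sum.cong)
    also have "(\<Sum>j<Suc K. c j * (real j * s ^ (j - 1))) = T' K s"
      unfolding T'_def d_def by (subst sum.lessThan_Suc_shift) (simp add: algebra_simps)
    finally show ?thesis .
  qed
  have T': "(T' K has_real_derivative T'' K s) (at s)" for K s
    unfolding T'_def T''_def by (auto intro!: derivative_eq_intros sum.cong)
  have T'_nonpos: "T' K s \<le> 0" if "0 \<le> s" for K s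
    unfolding T'_def using that d_nonpos by (intro sum_nonpos) (simp add: mult_nonpos_nonneg)
  \<comment> \<open>\<open>(1 - s) powr \<alpha>\<close> solves
    \<open>(1 - s) * y'' = (1 - \<alpha>) * y'\<close>. The recurrence \<open>d_Suc\<close> is this
    equation coefficient by coefficient, so truncation leaves only the top term.\<close>
  have telescope: "(1 - s) * T'' K s - (1 - \<alpha>) * T' K s = - (real K * d K * s ^ (K - 1))" for K s
  proof (induction K)
    case (Suc K)
    let ?p = "real K * s ^ (K - 1)"
    have "?p * s = real K * s ^ K"
      by (cases K) auto
    then have step: "(1 - s) * (d K * ?p) = real K * d K * s ^ (K - 1) - d K * (real K * s ^ K)"
      by (auto simp: algebra_simps)
    have "(1 - s) * T'' (Suc K) s - (1 - \<alpha>) * T' (Suc K) s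
        = ((1 - s) * T'' K s - (1 - \<alpha>) * T' K s) + (1 - s) * (d K * ?p) - (1 - \<alpha>) * (d K * s ^ K)"
      unfolding T''_def T'_def sum.lessThan_Suc by (simp only: distrib_left add_diff_add)
    also have "\<dots> = - ((real (Suc K) - \<alpha>) * d K * s ^ K)"
      unfolding Suc step by (simp add: algebra_simps)
    finally have "(1 - s) * T'' (Suc K) s - (1 - \<alpha>) * T' (Suc K) s
        = - ((real (Suc K) - \<alpha>) * d K * s ^ K)" .
    then show ?case
      by (simp only: d_Suc diff_Suc_1)
  qed (simp add: T''_def T'_def)
  have lim: "(\<lambda>K. T K s) \<longlonglongrightarrow> (1 - s) powr \<alpha>" if "0 \<le> s" "s < 1" for s
  proof -
    have "(\<lambda>j. (\<alpha> gchoose j) * (- s) ^ j) sums (1 + - s) powr \<alpha>"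
      using that by (intro gen_binomial_real) auto
    moreover have "(\<alpha> gchoose j) * (- s) ^ j = c j * s ^ j" for j
      unfolding c_def by (subst power_minus) simp
    ultimately have "(\<lambda>j. c j * s ^ j) sums (1 - s) powr \<alpha>" by simp
    then show ?thesis
      unfolding T_def sums_def by (rule LIMSEQ_Suc)
  qed
  \<comment> \<open>The difference is a sum of terms \<open>- c j * s ^ j\<close>, each nonnegative
    and increasing in \<open>s\<close>. Convergence at the single point \<open>s0\<close> therefore
    controls all of \<open>[0, s0]\<close>.\<close>
  have incr: "T K s - T (K + n) s \<le> T K s0 - T (K + n) s0 \<and> 0 \<le> T K s - T (K + n) s"
    if "0 \<le> s" "s \<le> s0" for K n s s0
  proof (induction n)
    case (Suc n)
    have "c (Suc (K + n)) * s0 ^ Suc (K + n) \<le> c (Suc (K + n)) * s ^ Suc (K + n)"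
      using that c_nonpos by (intro mult_left_mono_neg power_mono) auto
    moreover have "c (Suc (K + n)) * s ^ Suc (K + n) \<le> 0"
      using that c_nonpos by (intro mult_nonpos_nonneg) auto
    moreover have "T (K + Suc n) x = T (K + n) x + c (Suc (K + n)) * x ^ Suc (K + n)" for x
      by (simp add: T_def)
    ultimately show ?case using Suc by auto
  qed simp
  define s0 where "s0 = 1 - a"
  have s0: "0 \<le> s0" "s0 < 1" using a by (auto simp: s0_def)
  obtain K where K: "\<bar>T K s0 - (1 - s0) powr \<alpha>\<bar> < e"
    using LIMSEQ_D[OF lim[OF s0] e] by (metis le_refl real_norm_def)
  have err: "\<bar>T K s - (1 - s) powr \<alpha>\<bar> \<le> e" if s: "0 \<le> s" "s \<le> s0" for s
  proof -
    have lim': "(\<lambda>n. T K x - T (K + n) x) \<longlonglongrightarrow> T K x - (1 - x) powr \<alpha>" if "0 \<le> x" "x < 1" for x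
      using LIMSEQ_ignore_initial_segment[OF lim[OF that], of K]
      by (intro tendsto_diff tendsto_const) (simp add: add.commute)
    have "T K s - (1 - s) powr \<alpha> \<le> T K s0 - (1 - s0) powr \<alpha>"
      by (rule LIMSEQ_le[OF lim' lim']) (use s s0 incr[OF s] in auto)
    moreover have "0 \<le> T K s - (1 - s) powr \<alpha>"
      by (rule LIMSEQ_le_const[OF lim']) (use s s0 incr[OF s] in auto)
    ultimately show ?thesis using K by linarith
  qed
  show ?thesis
  proof (rule that[of "\<lambda>t. T K (1 - t)" "\<lambda>t. - T' K (1 - t)" "\<lambda>t. T'' K (1 - t)"])
    have "real_polynomial_function (\<lambda>t :: real. 1 - t)"
      by (intro real_polynomial_function_diff real_polynomial_function.intros(2)
          real_polynomial_function.intros(1) bounded_linear_ident)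
    then show "real_polynomial_function (\<lambda>t. T K (1 - t))"
      unfolding T_def
      by (intro real_polynomial_function_sum real_polynomial_function.intros(4)
          real_polynomial_function.intros(2) real_polynomial_function_power) auto
    have minus: "((\<lambda>t. 1 - t) has_real_derivative - 1) (at t)" for t :: real
      by (auto intro!: derivative_eq_intros)
    show "((\<lambda>t. T K (1 - t)) has_real_derivative - T' K (1 - t)) (at t)" for t
      using DERIV_chain2[where f = "T K" and g = "\<lambda>t. 1 - t", OF T minus[of t]] by simp
    show "((\<lambda>t. - T' K (1 - t)) has_real_derivative T'' K (1 - t)) (at t)" for t
      using DERIV_minus[OF DERIV_chain2[where f = "T' K" and g = "\<lambda>t. 1 - t", OF T' minus[of t]]]
      by simp
    show "0 \<le> - T' K (1 - t)" if "t \<le> 1" for t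
      using T'_nonpos[of "1 - t" K] that by simp
    show "0 \<le> t * T'' K (1 - t) + (1 - \<alpha>) * - T' K (1 - t)" if "t \<le> 1" for t
    proof -
      have "real K * d K * (1 - t) ^ (K - 1) \<le> 0"
        using that d_nonpos by (intro mult_nonpos_nonneg mult_nonneg_nonpos) auto
      then show ?thesis using telescope[of "1 - t" K] by simp
    qed
    show "\<bar>T K (1 - t) - t powr \<alpha>\<bar> \<le> e" if "a \<le> t" "t \<le> 1" for t
      using err[of "1 - t"] that by (simp add: s0_def)
  qed
qed

section \<open>First and second derivatives along lines\<close>

text \<open>\<open>D x v\<close> is the directional derivative and \<open>H x v\<close> the Hessian
  form at \<open>x\<close> in direction \<open>v\<close>. Derivatives along lines suffice, since
  convexity is tested on lines.\<close>

definition has_line_derivs ::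
    "('a::real_normed_vector \<Rightarrow> real) \<Rightarrow> ('a \<Rightarrow> 'a \<Rightarrow> real) \<Rightarrow> ('a \<Rightarrow> 'a \<Rightarrow> real) \<Rightarrow> bool" where
  "has_line_derivs p D H \<longleftrightarrow>
     (\<forall>x v t. ((\<lambda>t. p (x + t *\<^sub>R v)) has_real_derivative D (x + t *\<^sub>R v) v) (at t) \<and>
              ((\<lambda>t. D (x + t *\<^sub>R v) v) has_real_derivative H (x + t *\<^sub>R v) v) (at t))"

lemma has_line_derivsD:
  assumes "has_line_derivs p D H"
  shows "((\<lambda>t. p (x + t *\<^sub>R v)) has_real_derivative D (x + t *\<^sub>R v) v) (at t)"
    and "((\<lambda>t. D (x + t *\<^sub>R v) v) has_real_derivative H (x + t *\<^sub>R v) v) (at t)"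
  using assms by (auto simp: has_line_derivs_def)

text \<open>Transfers the growth bound, which is obtained for some Hessian of a polynomial, to a
  Hessian that is already fixed.\<close>

lemma has_line_derivs_unique:
  assumes "has_line_derivs p D H" "has_line_derivs p D' H'"
  shows "H = H'"
proof -
  have "D x v = D' x v" for x v
    using DERIV_unique[OF assms[THEN has_line_derivsD(1), of x v 0]] by simp
  then have "D = D'" by blast
  have "H x v = H' x v" for x v
    using DERIV_unique[OF has_line_derivsD(2)[OF assms(1), of x v 0]
        has_line_derivsD(2)[OF assms(2), of x v 0, folded \<open>D = D'\<close>]] by simp
  then show ?thesis by blast
qed

lemma has_line_derivs_const: "has_line_derivs (\<lambda>x. c) (\<lambda>x v. 0) (\<lambda>x v. 0)"
  by (simp add: has_line_derivs_def)

lemma has_line_derivs_linear: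
  assumes "linear f"
  shows "has_line_derivs f (\<lambda>x v. f v) (\<lambda>x v. 0)"
  using assms
  by (auto simp: has_line_derivs_def linear_add linear_cmul intro!: derivative_eq_intros)

lemma has_line_derivs_add:
  assumes "has_line_derivs p D H" "has_line_derivs q E J"
  shows "has_line_derivs (\<lambda>x. p x + q x) (\<lambda>x v. D x v + E x v) (\<lambda>x v. H x v + J x v)"
  using assms by (simp add: has_line_derivs_def DERIV_add)

lemma has_line_derivs_mult:
  assumes "has_line_derivs p D H" "has_line_derivs q E J"
  shows "has_line_derivs (\<lambda>x. p x * q x) (\<lambda>x v. D x v * q x + p x * E x v)
    (\<lambda>x v. H x v * q x + 2 * (D x v * E x v) + p x * J x v)"
  unfolding has_line_derivs_def
  by (auto intro!: derivative_eq_intros has_line_derivsD[OF assms(1)] has_line_derivsD[OF assms(2)])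

lemma has_line_derivs_sum:
  assumes "finite I" "\<And>i. i \<in> I \<Longrightarrow> has_line_derivs (p i) (D i) (H i)"
  shows "has_line_derivs (\<lambda>x. \<Sum>i\<in>I. p i x) (\<lambda>x v. \<Sum>i\<in>I. D i x v) (\<lambda>x v. \<Sum>i\<in>I. H i x v)"
  using assms
  by (induction I rule: finite_induct) (simp_all add: has_line_derivs_const has_line_derivs_add)

lemma has_line_derivs_compose:
  assumes p: "has_line_derivs p D H"
    and S: "\<And>t. (S has_real_derivative S' t) (at t)" "\<And>t. (S' has_real_derivative S'' t) (at t)"
  shows "has_line_derivs (\<lambda>x. S (p x)) (\<lambda>x v. S' (p x) * D x v)
    (\<lambda>x v. S'' (p x) * (D x v)\<^sup>2 + S' (p x) * H x v)"
proof -
  note c = DERIV_chain2[OF S(1) has_line_derivsD(1)[OF p]]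
    DERIV_chain2[OF S(2) has_line_derivsD(1)[OF p]]
  show ?thesis
    unfolding has_line_derivs_def
    by (auto intro!: derivative_eq_intros c has_line_derivsD(2)[OF p] simp: power2_eq_square)
qed

text \<open>Structural induction on the polynomial. The product rule for \<open>H\<close> involves
  values and first derivatives, so their bounds are carried along with one common \<open>C\<close>
  and \<open>d\<close>.\<close>

lemma real_polynomial_function_line_derivs:
  fixes p :: "'a::real_normed_vector \<Rightarrow> real"
  assumes "real_polynomial_function p"
  shows "\<exists>D H C d. has_line_derivs p D H \<and>
    (\<forall>x v. \<bar>p x\<bar> \<le> C * (1 + norm x) ^ d \<and>
      \<bar>D x v\<bar> \<le> C * (1 + norm x) ^ d * norm v \<and>
      \<bar>H x v\<bar> \<le> C * (1 + norm x) ^ d * (norm v)\<^sup>2)"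
  using assms
proof induction
  case (linear f)
  then interpret bounded_linear f .
  obtain C where C: "0 \<le> C" "\<And>x. \<bar>f x\<bar> \<le> norm x * C"
    using nonneg_bounded by (auto simp: mult.commute)
  have "\<bar>f x\<bar> \<le> C * (1 + norm x)" "\<bar>f v\<bar> \<le> C * (1 + norm x) * norm v" for x v
    using C(2)[of x] C(2)[of v] C(1) by (auto simp: algebra_simps intro: add_increasing2)
  then show ?case
    using has_line_derivs_linear[OF linear_axioms] C(1)
    by (intro exI[of _ C] exI[of _ 1] exI[of _ "\<lambda>x. f"] exI[of _ "\<lambda>x v. 0"]) auto
next
  case (const c)
  show ?case
    using has_line_derivs_const[of c]
    by (intro exI[of _ "\<bar>c\<bar>"] exI[of _ 0] exI[of _ "\<lambda>x v. 0"]) auto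
next
  case (add f g)
  then obtain D H C d E J B e where
    f: "has_line_derivs f D H" and g: "has_line_derivs g E J" and
    f_le: "\<And>x. \<bar>f x\<bar> \<le> C * (1 + norm x) ^ d"
      "\<And>x v. \<bar>D x v\<bar> \<le> C * (1 + norm x) ^ d * norm v"
      "\<And>x v. \<bar>H x v\<bar> \<le> C * (1 + norm x) ^ d * (norm v)\<^sup>2" and
    g_le: "\<And>x. \<bar>g x\<bar> \<le> B * (1 + norm x) ^ e"
      "\<And>x v. \<bar>E x v\<bar> \<le> B * (1 + norm x) ^ e * norm v"
      "\<And>x v. \<bar>J x v\<bar> \<le> B * (1 + norm x) ^ e * (norm v)\<^sup>2"
    by metis
  \<comment> \<open>The bounds on the values at \<open>0\<close> give the signs that allow both
    exponents to be raised to \<open>d + e\<close>.\<close>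
  have "0 \<le> C" "0 \<le> B"
    using f_le(1)[of 0] g_le(1)[of 0] by auto
  then have "C * (1 + norm x) ^ d \<le> C * (1 + norm x) ^ (d + e)"
      "B * (1 + norm x) ^ e \<le> B * (1 + norm x) ^ (d + e)" for x :: 'a
    by (auto intro!: mult_left_mono power_increasing)
  then have le: "C * (1 + norm x) ^ d + B * (1 + norm x) ^ e \<le> (C + B) * (1 + norm x) ^ (d + e)"
    for x :: 'a
    by (simp add: distrib_right add_mono)
  have "\<bar>s + t\<bar> \<le> (C + B) * (1 + norm x) ^ (d + e) * w"
    if "\<bar>s\<bar> \<le> C * (1 + norm x) ^ d * w" "\<bar>t\<bar> \<le> B * (1 + norm x) ^ e * w" "0 \<le> w"
    for x :: 'a and s t w
    using that mult_right_mono[OF le[of x] \<open>0 \<le> w\<close>] by (simp add: distrib_right)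
  note sum_le = this this[where w = 1, simplified]
  show ?case
    by (rule exI[of _ "\<lambda>x v. D x v + E x v"], rule exI[of _ "\<lambda>x v. H x v + J x v"],
        rule exI[of _ "C + B"], rule exI[of _ "d + e"])
      (intro conjI allI has_line_derivs_add[OF f g] sum_le f_le g_le norm_ge_zero zero_le_power2)
next
  case (mult f g)
  then obtain D H C d E J B e where
    f: "has_line_derivs f D H" and g: "has_line_derivs g E J" and
    f_le: "\<And>x. \<bar>f x\<bar> \<le> C * (1 + norm x) ^ d"
      "\<And>x v. \<bar>D x v\<bar> \<le> C * (1 + norm x) ^ d * norm v"
      "\<And>x v. \<bar>H x v\<bar> \<le> C * (1 + norm x) ^ d * (norm v)\<^sup>2" and
    g_le: "\<And>x. \<bar>g x\<bar> \<le> B * (1 + norm x) ^ e"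
      "\<And>x v. \<bar>E x v\<bar> \<le> B * (1 + norm x) ^ e * norm v"
      "\<And>x v. \<bar>J x v\<bar> \<le> B * (1 + norm x) ^ e * (norm v)\<^sup>2"
    by metis
  have prod_le: "\<bar>s * t\<bar> \<le> C * B * (1 + norm x) ^ (d + e) * (w * z)"
    if "\<bar>s\<bar> \<le> C * (1 + norm x) ^ d * w" "\<bar>t\<bar> \<le> B * (1 + norm x) ^ e * z"
    for x :: 'a and s t w z
    using mult_mono'[OF that] by (simp add: abs_mult power_add mult_ac)
  \<comment> \<open>The second derivative of a product has weight \<open>1 + 2 + 1 = 4\<close>; the
    same constant serves the other two bounds.\<close>
  have le: "\<bar>f x * g x\<bar> \<le> 4 * C * B * (1 + norm x) ^ (d + e)" for x
  proof -
    have "\<bar>f x * g x\<bar> \<le> C * B * (1 + norm x) ^ (d + e)"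
      using prod_le[of "f x" x 1 "g x" 1] f_le(1) g_le(1) by simp
    then show ?thesis by linarith
  qed
  have le': "\<bar>D x v * g x + f x * E x v\<bar> \<le> 4 * C * B * (1 + norm x) ^ (d + e) * norm v" for x v
  proof -
    have "\<bar>D x v * g x\<bar> \<le> C * B * (1 + norm x) ^ (d + e) * norm v"
      using prod_le[of "D x v" x "norm v" "g x" 1] f_le(2) g_le(1) by simp
    moreover have "\<bar>f x * E x v\<bar> \<le> C * B * (1 + norm x) ^ (d + e) * norm v"
      using prod_le[of "f x" x 1 "E x v" "norm v"] f_le(1) g_le(2) by simp
    ultimately show ?thesis by linarith
  qed
  have le'': "\<bar>H x v * g x + 2 * (D x v * E x v) + f x * J x v\<bar>
      \<le> 4 * C * B * (1 + norm x) ^ (d + e) * (norm v)\<^sup>2" for x v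
  proof -
    have "\<bar>H x v * g x\<bar> \<le> C * B * (1 + norm x) ^ (d + e) * (norm v)\<^sup>2"
      using prod_le[of "H x v" x "(norm v)\<^sup>2" "g x" 1] f_le(3) g_le(1) by simp
    moreover have "\<bar>D x v * E x v\<bar> \<le> C * B * (1 + norm x) ^ (d + e) * (norm v)\<^sup>2"
      using prod_le[of "D x v" x "norm v" "E x v" "norm v"] f_le(2) g_le(2)
      by (simp add: power2_eq_square)
    moreover have "\<bar>f x * J x v\<bar> \<le> C * B * (1 + norm x) ^ (d + e) * (norm v)\<^sup>2"
      using prod_le[of "f x" x 1 "J x v" "(norm v)\<^sup>2"] f_le(1) g_le(3) by simp
    ultimately show ?thesis by linarith
  qed
  show ?case
    by (rule exI[of _ "\<lambda>x v. D x v * g x + f x * E x v"],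
        rule exI[of _ "\<lambda>x v. H x v * g x + 2 * (D x v * E x v) + f x * J x v"],
        rule exI[of _ "4 * C * B"], rule exI[of _ "d + e"])
      (intro conjI allI has_line_derivs_mult[OF f g] le le' le'')
qed

lemma convex_on_line_derivs_nonneg:
  fixes p :: "'a::real_normed_vector \<Rightarrow> real"
  assumes p: "has_line_derivs p D H" and H: "\<And>x v. 0 \<le> H x v"
  shows "convex_on UNIV p"
proof (rule convex_onI)
  fix t :: real and x y :: 'a
  assume t: "0 < t" "t < 1"
  have "convex_on UNIV (\<lambda>t. p (x + t *\<^sub>R (y - x)))"
    by (rule f''_ge0_imp_convex[OF _ has_line_derivsD(1)[OF p] has_line_derivsD(2)[OF p]])
      (simp_all add: H)
  from convex_onD[OF this, of t 0 1] t
  show "p ((1 - t) *\<^sub>R x + t *\<^sub>R y) \<le> (1 - t) * p x + t * p y"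
    by (simp add: algebra_simps)
qed simp

section \<open>Affine minorants of a convex function\<close>

text \<open>A finite convex function is continuous, so its epigraph is closed and convex. A
  hyperplane strictly separating it from the point \<open>(y, f y - e)\<close> below the graph is
  the graph of the minorant.\<close>

lemma convex_on_affine_minorant:
  fixes f :: "'a::euclidean_space \<Rightarrow> real"
  assumes f: "convex_on UNIV f" and e: "0 < e"
  obtains a c where "\<And>x. a \<bullet> x + c \<le> f x" "f y - e < a \<bullet> y + c"
proof -
  have "continuous_on UNIV f"
    using convex_on_continuous[OF open_UNIV f] .
  then have "continuous_on UNIV (\<lambda>z :: 'a \<times> real. f (fst z))"
    by (rule continuous_on_compose2[OF _ continuous_on_fst[OF continuous_on_id]]) simp
  then have "closed {z. f (fst z) \<le> snd z}"
    by (rule closed_Collect_le[OF _ continuous_on_snd[OF continuous_on_id]])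
  then have "closed (epigraph UNIV f)"
    by (simp add: epigraph_def)
  moreover have "(y, f y - e) \<notin> epigraph UNIV f"
    using e by (simp add: epigraph_def)
  ultimately obtain A b where A: "A \<bullet> (y, f y - e) < b" "\<And>z. z \<in> epigraph UNIV f \<Longrightarrow> b < A \<bullet> z"
    using separating_hyperplane_closed_point[OF convex_epigraphI[OF f]] by blast
  obtain u s where us: "A = (u, s)" by (cases A)
  have low: "u \<bullet> y + s * (f y - e) < b" and up: "b < u \<bullet> x + s * f x" for x
    using A(1) A(2)[of "(x, f x)"] by (simp_all add: us epigraph_def)
  \<comment> \<open>Comparing both sides at \<open>y\<close> shows that the hyperplane is not
    vertical, so it can be solved for the last coordinate.\<close>
  have "0 < s * e"
    using low up[of y] by (simp add: algebra_simps)
  then have s: "0 < s"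
    using e by (simp add: zero_less_mult_iff)
  show ?thesis
  proof
    show "(- (1 / s) *\<^sub>R u) \<bullet> x + b / s \<le> f x" for x
      using up[of x] s by (simp add: field_simps)
    show "f y - e < (- (1 / s) *\<^sub>R u) \<bullet> y + b / s"
      using low s by (simp add: field_simps)
  qed
qed

text \<open>The open sets on which one minorant is \<open>e\<close>-close to \<open>f\<close> cover
  the compact set \<open>K\<close>; a finite subcover selects the minorants.\<close>

lemma convex_on_finite_affine_minorants:
  fixes f :: "'a::euclidean_space \<Rightarrow> real"
  assumes f: "convex_on UNIV f" and e: "0 < e" and K: "compact K"
  obtains I where "finite I" "\<And>i x. i \<in> I \<Longrightarrow> fst i \<bullet> x + snd i \<le> f x"
    "\<And>x. x \<in> K \<Longrightarrow> \<exists>i\<in>I. f x - e < fst i \<bullet> x + snd i"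
proof -
  define A where "A = {i :: 'a \<times> real. \<forall>x. fst i \<bullet> x + snd i \<le> f x}"
  define U where "U i = {x. f x - e < fst i \<bullet> x + snd i}" for i
  have "continuous_on UNIV f"
    using convex_on_continuous[OF open_UNIV f] .
  then have "open (U i)" for i
    unfolding U_def by (intro open_Collect_less continuous_intros)
  moreover have "K \<subseteq> (\<Union>i\<in>A. U i)"
  proof
    fix y
    obtain a c where ac: "\<And>x. a \<bullet> x + c \<le> f x" "f y - e < a \<bullet> y + c"
      using convex_on_affine_minorant[OF f e, where y = y] by metis
    show "y \<in> (\<Union>i\<in>A. U i)"
    proof
      show "(a, c) \<in> A" using ac(1) by (simp add: A_def)
      show "y \<in> U (a, c)" using ac(2) by (simp add: U_def)
    qed
  qed
  ultimately obtain I where I: "I \<subseteq> A" "finite I" "K \<subseteq> (\<Union>i\<in>I. U i)"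
    using compactE_image[OF K, of A U] by metis
  show ?thesis
  proof
    show "finite I" by fact
    show "fst i \<bullet> x + snd i \<le> f x" if "i \<in> I" for i x
      using that I(1) by (auto simp: A_def)
    show "\<exists>i\<in>I. f x - e < fst i \<bullet> x + snd i" if "x \<in> K" for x
      using that I(3) by (auto simp: U_def)
  qed
qed

section \<open>Approximation by polynomials that are convex on a ball\<close>

lemma real_polynomial_function_affine:
  "real_polynomial_function (\<lambda>x :: 'a::real_inner. a \<bullet> x + c)"
  by (intro real_polynomial_function.intros(3) real_polynomial_function.intros(2)
      real_polynomial_function.intros(1) bounded_linear_inner_right)

lemma has_line_derivs_affine: "has_line_derivs (\<lambda>x. a \<bullet> x + c) (\<lambda>x v. a \<bullet> v) (\<lambda>x v. 0)"
  using has_line_derivs_add[OF has_line_derivs_linear[of "\<lambda>x. a \<bullet> x"] has_line_derivs_const[of c]]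
  by (simp add: bounded_linear.linear[OF bounded_linear_inner_right])

text \<open>Error budget, in units of \<open>\<delta>\<close> after division by
  \<open>\<Lambda>\<close>: the root of \<open>g\<close> lies between \<open>2 * \<delta>\<close>
  below \<open>f\<close> (affine minorants) and \<open>\<delta>\<close> above it (norm against
  maximum), and the truncated series adds at most \<open>\<delta>\<close>, so the total is below
  \<open>e = 4 * \<delta> * \<Lambda>\<close>.\<close>

lemma convex_on_polynomial_approx_locally_convex:
  fixes f :: "'a::euclidean_space \<Rightarrow> real"
  assumes f: "convex_on UNIV f" and e: "0 < e" and r: "0 \<le> r"
  obtains p D H where "real_polynomial_function p" "has_line_derivs p D H"
    "\<And>x v. norm x \<le> r \<Longrightarrow> 0 \<le> H x v" "\<And>x. norm x \<le> r \<Longrightarrow> \<bar>p x - f x\<bar> \<le> e"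
proof -
  obtain I where I: "finite I" and I_le: "\<And>i x. i \<in> I \<Longrightarrow> fst i \<bullet> x + snd i \<le> f x"
    and I_ex: "\<And>x. norm x \<le> r \<Longrightarrow> \<exists>i\<in>I. f x - e / 2 < fst i \<bullet> x + snd i"
    using convex_on_finite_affine_minorants[OF f, of "e / 2" "cball 0 r"] e by auto
  define N where "N = real (card I)"
  have "I \<noteq> {}" using I_ex[of 0] r by auto
  then have N: "1 \<le> N"
    using I card_gt_0_iff[of I] by (simp add: N_def)
  define B where "B = (\<Sum>i\<in>I. norm (fst i) * r + \<bar>snd i\<bar>)"
  have B: "\<bar>fst i \<bullet> x + snd i\<bar> \<le> B" if "i \<in> I" "norm x \<le> r" for i x
  proof -
    have "\<bar>fst i \<bullet> x\<bar> \<le> norm (fst i) * r"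
      using Cauchy_Schwarz_ineq2[of "fst i" x] mult_left_mono[OF that(2) norm_ge_zero[of "fst i"]]
      by linarith
    moreover have "norm (fst i) * r + \<bar>snd i\<bar> \<le> B"
      unfolding B_def using I r that(1) by (intro member_le_sum) auto
    ultimately show ?thesis by linarith
  qed
  have "0 \<le> B" unfolding B_def using r by (intro sum_nonneg) auto
  \<comment> \<open>Adding \<open>B + 1\<close> moves the affine values on the ball into
    \<open>[1, 2 * B + 1]\<close>; dividing by \<open>\<Lambda>\<close> moves them into
    \<open>[1 / \<Lambda>, 1 / N]\<close>, so that the sum of their \<open>M\<close>-th powers is at
    most \<open>1\<close>.\<close>
  define \<Lambda> where "\<Lambda> = (2 * B + 1) * N"
  have \<Lambda>: "0 < \<Lambda>" "2 * B + 1 = \<Lambda> / N"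
    using \<open>0 \<le> B\<close> N by (auto simp: \<Lambda>_def)
  define \<delta> where "\<delta> = e / (4 * \<Lambda>)"
  have \<delta>: "0 < \<delta>" "e = 4 * \<delta> * \<Lambda>" using e \<Lambda> by (auto simp: \<delta>_def)
  \<comment> \<open>Chosen so that \<open>\<eta> * \<phi> \<le> \<delta>\<close> below, where the
    normalized value \<open>\<phi>\<close> of \<open>f\<close> is at most
    \<open>1 + 2 * \<delta>\<close>.\<close>
  define \<eta> where "\<eta> = \<delta> / (1 + 2 * \<delta>)"
  have \<eta>: "0 < \<eta>" "\<eta> * (1 + 2 * \<delta>) = \<delta>" using \<delta>(1) by (auto simp: \<eta>_def)
  have "(\<lambda>n. root n N) \<longlonglongrightarrow> 1"
    using N by (intro LIMSEQ_root_const) auto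
  then obtain k where "\<And>n. k \<le> n \<Longrightarrow> \<bar>root n N - 1\<bar> < \<eta>"
    using LIMSEQ_D[OF _ \<eta>(1)] by (metis real_norm_def)
  then have root_N: "root (2 * k + 2) N \<le> 1 + \<eta>"
    by (metis abs_le_D1 add.commute diff_le_eq less_imp_le le_add1 mult_2 add.assoc)
  \<comment> \<open>For even \<open>M\<close> the exponent \<open>M - 1 = (k + 1) + k\<close> splits
    as Cauchy-Schwarz requires, and \<open>g_conv\<close> holds at every point, whatever the sign of
    \<open>w i x\<close>.\<close>
  define M where "M = 2 * k + 2"
  have M: "0 < M" by (simp add: M_def)
  define w where "w i x = ((1 / \<Lambda>) *\<^sub>R fst i) \<bullet> x + (snd i + B + 1) / \<Lambda>" for i :: "'a \<times> real" and x
  have w_eq: "w i x = (fst i \<bullet> x + snd i + B + 1) / \<Lambda>" for i x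
    by (simp add: w_def add_divide_distrib)
  have w_ge: "1 / \<Lambda> \<le> w i x" and w_le: "w i x \<le> 1 / N" if "i \<in> I" "norm x \<le> r" for i x
  proof -
    show "1 / \<Lambda> \<le> w i x"
      unfolding w_eq using B[OF that] \<Lambda> by (intro divide_right_mono) auto
    have "fst i \<bullet> x + snd i + B + 1 \<le> \<Lambda> / N"
      unfolding \<Lambda>(2)[symmetric] using B[OF that] by linarith
    then show "w i x \<le> 1 / N"
      unfolding w_eq using \<Lambda> N by (simp add: field_simps)
  qed
  have w_pos: "0 < w i x" if "i \<in> I" "norm x \<le> r" for i x
    using less_le_trans[OF _ w_ge[OF that]] \<Lambda>(1) by simp
  define g where "g x = (\<Sum>i\<in>I. w i x ^ M)" for x
  define Dg where "Dg x v = (\<Sum>i\<in>I. real M * w i x ^ (2 * k + 1) * ((1 / \<Lambda>) *\<^sub>R fst i \<bullet> v))" for x v :: 'a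
  define Hg where "Hg x v = (\<Sum>i\<in>I. real M * (real (2 * k + 1) * w i x ^ (2 * k)) *
    ((1 / \<Lambda>) *\<^sub>R fst i \<bullet> v)\<^sup>2)" for x v :: 'a
  have g: "has_line_derivs g Dg Hg"
  proof -
    have "((\<lambda>t. t ^ M) has_real_derivative real M * t ^ (2 * k + 1)) (at t)"
      and "((\<lambda>t. real M * t ^ (2 * k + 1)) has_real_derivative
        real M * (real (2 * k + 1) * t ^ (2 * k))) (at t)" for t :: real
      using DERIV_pow[of M t] DERIV_cmult[OF DERIV_pow[of "2 * k + 1" t], of "real M"]
      by (simp_all add: M_def)
    from has_line_derivs_compose[OF has_line_derivs_affine this]
    have "has_line_derivs (\<lambda>x. w i x ^ M)
        (\<lambda>x v. real M * w i x ^ (2 * k + 1) * ((1 / \<Lambda>) *\<^sub>R fst i \<bullet> v))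
        (\<lambda>x v. real M * (real (2 * k + 1) * w i x ^ (2 * k)) * ((1 / \<Lambda>) *\<^sub>R fst i \<bullet> v)\<^sup>2)" for i
      unfolding w_def by (simp only: mult_zero_right add_0_right)
    then show ?thesis
      unfolding g_def Dg_def Hg_def by (intro has_line_derivs_sum[OF I])
  qed
  \<comment> \<open>Cauchy-Schwarz for \<open>w i x ^ (k + 1)\<close> and
    \<open>w i x ^ k * b i\<close>, with \<open>b i\<close> the derivative of \<open>w i\<close>
    along \<open>v\<close>. The factor \<open>1 - 1 / M\<close> is exactly what remains of
    \<open>M\<close> and \<open>M - 1 = 2 * k + 1\<close>.\<close>
  have g_conv: "(1 - 1 / real M) * (Dg x v)\<^sup>2 \<le> g x * Hg x v" for x v
  proof -
    define b where "b i = (1 / \<Lambda>) *\<^sub>R fst i \<bullet> v" for i :: "'a \<times> real"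
    have "Dg x v = real M * (\<Sum>i\<in>I. w i x ^ (k + 1) * (w i x ^ k * b i))"
    proof -
      have "z ^ (2 * k + 1) = z ^ (k + 1) * z ^ k" for z :: real
        by (simp add: mult_2 power_add)
      then show ?thesis
        unfolding Dg_def b_def by (simp only: sum_distrib_left mult_ac)
    qed
    moreover have "(\<Sum>i\<in>I. w i x ^ (k + 1) * (w i x ^ k * b i))\<^sup>2
        \<le> (\<Sum>i\<in>I. (w i x ^ (k + 1))\<^sup>2) * (\<Sum>i\<in>I. (w i x ^ k * b i)\<^sup>2)"
      by (rule Cauchy_Schwarz_ineq_sum)
    moreover have "(\<Sum>i\<in>I. (w i x ^ (k + 1))\<^sup>2) = g x"
    proof -
      have "(k + 1) * 2 = M" by (simp add: M_def)
      then show ?thesis unfolding g_def by (simp only: power_mult[symmetric])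
    qed
    moreover have "Hg x v = real M * real (2 * k + 1) * (\<Sum>i\<in>I. (w i x ^ k * b i)\<^sup>2)"
      unfolding Hg_def b_def
      by (simp only: sum_distrib_left power_mult_distrib power_mult[symmetric] mult_ac)
    ultimately have "(Dg x v)\<^sup>2 \<le> (real M)\<^sup>2 * (g x * (Hg x v / (real M * real (2 * k + 1))))"
      using M by (simp add: power_mult_distrib)
    then have "(1 - 1 / real M) * (Dg x v)\<^sup>2
        \<le> (1 - 1 / real M) * ((real M)\<^sup>2 * (g x * (Hg x v / (real M * real (2 * k + 1)))))"
      using M by (intro mult_left_mono) auto
    also have "\<dots> = g x * Hg x v"
    proof -
      have "1 - 1 / real M = real (2 * k + 1) / real M"
        using M by (simp add: M_def field_simps)
      then show ?thesis using M by (simp add: power2_eq_square)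
    qed
    finally show ?thesis .
  qed
  \<comment> \<open>A positive lower bound of \<open>g\<close> on the ball: the series approximates
    the root uniformly only away from \<open>0\<close>.\<close>
  define a where "a = (1 / \<Lambda>) ^ M"
  have w_pow: "w i x ^ M \<le> g x" if "i \<in> I" "norm x \<le> r" for i x
    unfolding g_def using I that w_pos[OF _ that(2)]
    by (intro member_le_sum[where f = "\<lambda>i. w i x ^ M"]) (simp_all add: less_imp_le)
  have a_le: "a \<le> g x" if "norm x \<le> r" for x
  proof -
    obtain i where i: "i \<in> I" using \<open>I \<noteq> {}\<close> by blast
    have "a \<le> w i x ^ M"
      unfolding a_def using w_ge[OF i that] \<Lambda>(1) by (intro power_mono) auto
    then show ?thesis using w_pow[OF i that] by linarith
  qed
  have g_sum_le: "g x \<le> N * c ^ M" if "norm x \<le> r" "\<And>i. i \<in> I \<Longrightarrow> w i x \<le> c" for x c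
  proof -
    have "w i x ^ M \<le> c ^ M" if "i \<in> I" for i
      using w_pos[OF that \<open>norm x \<le> r\<close>] \<open>\<And>i. i \<in> I \<Longrightarrow> w i x \<le> c\<close>[OF that]
      by (intro power_mono) auto
    then show ?thesis
      unfolding g_def N_def by (rule sum_bounded_above)
  qed
  have g_le: "g x \<le> 1" if "norm x \<le> r" for x
  proof -
    have "(1 / N) ^ M \<le> 1 / N"
      using power_decreasing[of 1 M "1 / N"] N M by simp
    then have "N * (1 / N) ^ M \<le> 1"
      using N by (simp add: field_simps)
    then show ?thesis
      using g_sum_le[OF that w_le[OF _ that]] by linarith
  qed
  have a: "0 < a" "a \<le> 1"
    using \<Lambda>(1) a_le[of 0] g_le[of 0] r by (auto simp: a_def)
  obtain S S' S'' where S: "real_polynomial_function S"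
    "\<And>t. (S has_real_derivative S' t) (at t)" "\<And>t. (S' has_real_derivative S'' t) (at t)"
    and S'_nonneg: "\<And>t. t \<le> 1 \<Longrightarrow> 0 \<le> S' t"
    and S''_ge: "\<And>t. t \<le> 1 \<Longrightarrow> 0 \<le> t * S'' t + (1 - 1 / real M) * S' t"
    and S_approx: "\<And>t. a \<le> t \<Longrightarrow> t \<le> 1 \<Longrightarrow> \<bar>S t - t powr (1 / real M)\<bar> \<le> \<delta>"
    using truncated_binomial_series_root[of "1 / real M" a \<delta>] a \<delta>(1) M by auto
  show ?thesis
  proof
    have "real_polynomial_function g"
      unfolding g_def w_def
      by (intro real_polynomial_function_sum real_polynomial_function_power
          real_polynomial_function_affine I)
    then have "real_polynomial_function (\<lambda>x. S (g x))"
      using polynomial_function_compose[of g S] S(1)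
      by (simp add: real_polynomial_function_eq o_def)
    then show "real_polynomial_function (\<lambda>x. \<Lambda> * S (g x) - (B + 1))"
      by (intro real_polynomial_function_diff real_polynomial_function.intros(4)
          real_polynomial_function.intros(2))
    show "has_line_derivs (\<lambda>x. \<Lambda> * S (g x) - (B + 1)) (\<lambda>x v. \<Lambda> * S' (g x) * Dg x v)
        (\<lambda>x v. \<Lambda> * S'' (g x) * (Dg x v)\<^sup>2 + \<Lambda> * S' (g x) * Hg x v)"
      by (rule has_line_derivs_compose[OF g]) (auto intro!: derivative_eq_intros S(2,3))
    show "0 \<le> \<Lambda> * S'' (g x) * (Dg x v)\<^sup>2 + \<Lambda> * S' (g x) * Hg x v" if "norm x \<le> r" for x v
    proof -
      have gx: "0 < g x" "g x \<le> 1"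
        using a_le[OF that] g_le[OF that] a by auto
      \<comment> \<open>\<open>S''\<close> can be negative. Multiplying the Hessian by
        \<open>g x > 0\<close> lets \<open>g_conv\<close> trade \<open>g x * Hg x v\<close> for
        \<open>(1 - 1 / M) * (Dg x v)\<^sup>2\<close>, which the inequality for \<open>S\<close> can
        absorb.\<close>
      have "0 \<le> (g x * S'' (g x) + (1 - 1 / real M) * S' (g x)) * (Dg x v)\<^sup>2"
        using S''_ge[OF gx(2)] by simp
      moreover have "S' (g x) * ((1 - 1 / real M) * (Dg x v)\<^sup>2) \<le> S' (g x) * (g x * Hg x v)"
        using S'_nonneg[OF gx(2)] g_conv by (intro mult_left_mono)
      ultimately have "0 \<le> g x * (S'' (g x) * (Dg x v)\<^sup>2 + S' (g x) * Hg x v)"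
        by (simp add: algebra_simps)
      then have "0 \<le> S'' (g x) * (Dg x v)\<^sup>2 + S' (g x) * Hg x v"
        using gx(1) by (simp add: zero_le_mult_iff)
      then have "0 \<le> \<Lambda> * (S'' (g x) * (Dg x v)\<^sup>2 + S' (g x) * Hg x v)"
        using \<Lambda>(1) by simp
      then show ?thesis by (simp add: algebra_simps)
    qed
    show "\<bar>\<Lambda> * S (g x) - (B + 1) - f x\<bar> \<le> e" if x: "norm x \<le> r" for x
    proof -
      \<comment> \<open>\<open>\<phi>\<close> is \<open>f x\<close> after the normalization. It
        bounds every \<open>w j x\<close> from above and exceeds the chosen \<open>w i x\<close> by
        at most \<open>2 * \<delta>\<close>.\<close>
      define \<phi> where "\<phi> = (f x + B + 1) / \<Lambda>"
      obtain i where i: "i \<in> I" "f x - e / 2 < fst i \<bullet> x + snd i"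
        using I_ex[OF x] by blast
      have "\<phi> - 2 * \<delta> = (f x - e / 2 + B + 1) / \<Lambda>"
        using \<Lambda>(1) by (simp add: \<phi>_def \<delta>_def field_simps)
      also have "\<dots> \<le> w i x"
        unfolding w_eq using i(2) \<Lambda>(1) by (intro divide_right_mono) auto
      finally have \<phi>_le: "\<phi> - 2 * \<delta> \<le> w i x" .
      have w_le_\<phi>: "w j x \<le> \<phi>" if "j \<in> I" for j
        unfolding w_eq \<phi>_def using I_le[OF that, of x] \<Lambda>(1) by (intro divide_right_mono) auto
      have wi: "0 < w i x" "w i x \<le> 1"
        using w_pos[OF i(1) x] order_trans[OF w_le[OF i(1) x]] N by auto
      have \<phi>: "0 < \<phi>" using w_le_\<phi>[OF i(1)] wi by linarith
      have "w i x = root M (w i x ^ M)"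
        using M wi by (simp add: real_root_power_cancel)
      also have "\<dots> \<le> root M (g x)"
        using M w_pow[OF i(1) x] by (intro real_root_le_mono)
      finally have root_ge: "\<phi> - 2 * \<delta> \<le> root M (g x)" using \<phi>_le by linarith
      have "root M (g x) \<le> root M (N * \<phi> ^ M)"
        using M g_sum_le[OF x w_le_\<phi>] by (intro real_root_le_mono) auto
      also have "\<dots> = root M N * \<phi>"
        using M \<phi> by (simp add: real_root_mult real_root_power_cancel)
      also have "\<dots> \<le> (1 + \<eta>) * \<phi>"
        using root_N \<phi> by (intro mult_right_mono) (auto simp: M_def)
      also have "\<dots> \<le> \<phi> + \<delta>"
      proof -
        have "\<eta> * \<phi> \<le> \<eta> * (1 + 2 * \<delta>)"
          using \<phi>_le wi \<eta>(1) by (intro mult_left_mono) auto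
        then show ?thesis by (simp add: \<eta>(2) distrib_right)
      qed
      finally have root_le: "root M (g x) \<le> \<phi> + \<delta>" .
      have "g x powr (1 / real M) = root M (g x)"
        using a_le[OF x] a M by (simp add: root_powr_inverse)
      then have "\<bar>S (g x) - \<phi>\<bar> \<le> 3 * \<delta>"
        using S_approx[OF a_le[OF x] g_le[OF x]] root_ge root_le by linarith
      then have "\<Lambda> * \<bar>S (g x) - \<phi>\<bar> \<le> \<Lambda> * (3 * \<delta>)"
        using \<Lambda>(1) by (intro mult_left_mono) auto
      also have "\<dots> \<le> e"
        unfolding \<delta>(2) using \<delta>(1) \<Lambda>(1) by simp
      finally have "\<bar>\<Lambda> * (S (g x) - \<phi>)\<bar> \<le> e"
        using \<Lambda>(1) by (simp add: abs_mult)
      moreover have "\<Lambda> * (S (g x) - \<phi>) = \<Lambda> * S (g x) - (B + 1) - f x"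
        using \<Lambda>(1) by (simp add: \<phi>_def field_simps)
      ultimately show ?thesis by simp
    qed
  qed
qed

section \<open>From convexity on a ball to global convexity\<close>

lemma locally_convex_polynomial_approx_convex:
  fixes p :: "'a::euclidean_space \<Rightarrow> real"
  assumes p: "real_polynomial_function p" "has_line_derivs p D H"
    and H: "\<And>x v. norm x \<le> 2 * R \<Longrightarrow> 0 \<le> H x v" and R: "1 \<le> R" and e: "0 < e"
  obtains q where "real_polynomial_function q" "convex_on UNIV q"
    "\<And>x. norm x \<le> R \<Longrightarrow> \<bar>q x - p x\<bar> \<le> e"
proof -
  obtain C d where C: "\<And>x v. \<bar>H x v\<bar> \<le> C * (1 + norm x) ^ d * (norm v)\<^sup>2"
    using real_polynomial_function_line_derivs[OF p(1)] has_line_derivs_unique[OF p(2)] by metis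
  \<comment> \<open>Outside the ball of radius \<open>2 * R\<close> the quantity
    \<open>u = |x|^2 / R^2\<close> is at least \<open>4\<close>. There \<open>u ^ d\<close> absorbs
    the growth of \<open>H\<close>, and \<open>u ^ k \<ge> 4 ^ k\<close> the constants collected
    here; hence \<open>m = d + k\<close>.\<close>
  obtain k where k: "\<bar>C\<bar> * (4 * R\<^sup>2) ^ d * R\<^sup>2 / (2 * e) < 4 ^ k"
    using real_arch_pow[of 4] by auto
  define m where "m = d + k"
  define b where "b = 1 / R\<^sup>2"
  have b: "0 < b" using R by (simp add: b_def)
  \<comment> \<open>The exponent is \<open>m + 1\<close> so that the derivative \<open>S'\<close>
    carries \<open>u ^ m\<close>.\<close>
  define S where "S t = e * (b * t) ^ (m + 1)" for t
  define S' where "S' t = e * (real (m + 1) * (b * t) ^ m * b)" for t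
  define S'' where "S'' t = e * (real (m + 1) * (real m * (b * t) ^ (m - 1) * b) * b)" for t
  have S: "(S has_real_derivative S' t) (at t)" "(S' has_real_derivative S'' t) (at t)" for t
  proof -
    have pow: "((\<lambda>t. (b * t) ^ n) has_real_derivative real n * (b * t) ^ (n - 1) * b) (at t)" for n
      using DERIV_chain2[OF DERIV_pow DERIV_cmult_Id] by simp
    show "(S has_real_derivative S' t) (at t)"
      unfolding S_def S'_def using DERIV_cmult[OF pow[of "m + 1"], of e] by simp
    show "(S' has_real_derivative S'' t) (at t)"
      unfolding S'_def S''_def
      using DERIV_cmult[OF pow[of m], of "e * real (m + 1) * b"] by (simp add: mult_ac)
  qed
  have sq: "has_line_derivs (\<lambda>x. x \<bullet> x) (\<lambda>x v. 2 * (x \<bullet> v)) (\<lambda>x v :: 'a. 2 * (v \<bullet> v))"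
    unfolding has_line_derivs_def
    by (auto intro!: derivative_eq_intros simp: inner_add inner_commute algebra_simps)
  show ?thesis
  proof
    have "real_polynomial_function (\<lambda>x :: 'a. x \<bullet> x)"
      by (subst euclidean_inner, intro real_polynomial_function_sum real_polynomial_function.intros(4)
          real_polynomial_function.intros(1) bounded_linear_inner_left finite_Basis)
    then have "real_polynomial_function (\<lambda>x :: 'a. S (x \<bullet> x))"
      unfolding S_def
      by (intro real_polynomial_function.intros(4) real_polynomial_function.intros(2)
          real_polynomial_function_power)
    then show "real_polynomial_function (\<lambda>x. p x + S (x \<bullet> x))"
      by (intro real_polynomial_function.intros(3) p)
    show "convex_on UNIV (\<lambda>x. p x + S (x \<bullet> x))"
    proof (rule convex_on_line_derivs_nonneg[OF has_line_derivs_add[OF p(2)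
            has_line_derivs_compose[OF sq S]]])
      fix x v :: 'a
      \<comment> \<open>This part of the Hessian of \<open>S (x \<bullet> x)\<close> only helps;
        \<open>S'\<close> alone has to compensate a negative \<open>H\<close>.\<close>
      have "0 \<le> S'' (x \<bullet> x) * (2 * (x \<bullet> v))\<^sup>2"
        unfolding S''_def using e b by simp
      moreover have "0 \<le> H x v + S' (x \<bullet> x) * (2 * (v \<bullet> v))"
      proof (cases "norm x \<le> 2 * R")
        case True
        moreover have "0 \<le> S' (x \<bullet> x)"
          unfolding S'_def using e b by simp
        ultimately show ?thesis using H by simp
      next
        case False
        define u where "u = b * (norm x)\<^sup>2"
        have nx: "(norm x)\<^sup>2 = R\<^sup>2 * u" using R by (simp add: u_def b_def)
        have "(2 * R)\<^sup>2 \<le> (norm x)\<^sup>2"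
          using False R by (intro power_mono) auto
        then have u: "4 \<le> u"
          using R by (simp add: u_def b_def field_simps)
        \<comment> \<open>Since \<open>norm x \<ge> 1\<close>, replacing \<open>1 + norm x\<close>
          by \<open>4 * (norm x)\<^sup>2\<close> turns the growth bound into a power of
          \<open>u\<close>.\<close>
        have "(1 + norm x) ^ d \<le> ((2 * norm x)\<^sup>2) ^ d"
        proof (rule power_mono)
          have "1 * (1 + norm x) \<le> (2 * norm x) * (2 * norm x)"
            using False R by (intro mult_mono) auto
          then show "1 + norm x \<le> (2 * norm x)\<^sup>2"
            by (simp add: power2_eq_square)
        qed simp
        also have "\<dots> = (4 * R\<^sup>2) ^ d * u ^ d"
          by (simp add: nx power_mult_distrib)
        finally have "\<bar>C\<bar> * (1 + norm x) ^ d \<le> \<bar>C\<bar> * ((4 * R\<^sup>2) ^ d * u ^ d)"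
          by (intro mult_left_mono) auto
        also have "\<dots> = (\<bar>C\<bar> * (4 * R\<^sup>2) ^ d * R\<^sup>2 / (2 * e)) * (2 * e / R\<^sup>2 * u ^ d)"
          using R e by simp
        also have "\<dots> \<le> u ^ k * (2 * e / R\<^sup>2 * u ^ d)"
        proof (rule mult_right_mono)
          have "4 ^ k \<le> u ^ k" using u by (intro power_mono) auto
          then show "\<bar>C\<bar> * (4 * R\<^sup>2) ^ d * R\<^sup>2 / (2 * e) \<le> u ^ k" using k by linarith
        qed (use u e in simp)
        also have "\<dots> = 2 * (e * (1 * u ^ m * b))"
          by (simp add: m_def b_def power_add)
        \<comment> \<open>The factor \<open>1\<close> is enlarged to
          \<open>real (m + 1)\<close>.\<close>
        also have "\<dots> \<le> 2 * S' (x \<bullet> x)"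
          unfolding S'_def u_def power2_norm_eq_inner using e b
          by (intro mult_left_mono mult_right_mono) auto
        finally have "\<bar>C\<bar> * (1 + norm x) ^ d * (norm v)\<^sup>2 \<le> 2 * S' (x \<bullet> x) * (norm v)\<^sup>2"
          by (rule mult_right_mono) simp
        moreover have "C * (1 + norm x) ^ d * (norm v)\<^sup>2 \<le> \<bar>C\<bar> * (1 + norm x) ^ d * (norm v)\<^sup>2"
          by (intro mult_right_mono) auto
        ultimately show ?thesis
          using C[of x v] by (simp add: power2_norm_eq_inner mult_ac)
      qed
      ultimately show "0 \<le> H x v + (S'' (x \<bullet> x) * (2 * (x \<bullet> v))\<^sup>2 + S' (x \<bullet> x) * (2 * (v \<bullet> v)))"
        by linarith
    qed
    show "\<bar>p x + S (x \<bullet> x) - p x\<bar> \<le> e" if "norm x \<le> R" for x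
    proof -
      have "(norm x)\<^sup>2 \<le> R\<^sup>2"
        using that by (intro power_mono) auto
      then have "(b * (x \<bullet> x)) ^ (m + 1) \<le> 1"
        using R by (intro power_le_one) (auto simp: b_def power2_norm_eq_inner)
      then show ?thesis
        using e b by (simp add: S_def abs_mult)
    qed
  qed
qed

section \<open>Density of convex polynomials and conclusion\<close>

text \<open>The first approximation is made on the doubled ball, because making it globally convex
  requires convexity up to radius \<open>2 * R\<close>. Two errors of \<open>e / 3\<close> leave the
  inequality strict.\<close>

lemma convex_polynomials_dense:
  fixes f :: "'a::euclidean_space \<Rightarrow> real"
  assumes f: "convex_on UNIV f" and K: "compact K" and e: "0 < e"
  obtains q where "real_polynomial_function q" "convex_on UNIV q" "\<And>x. x \<in> K \<Longrightarrow> \<bar>q x - f x\<bar> < e"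
proof -
  obtain R0 where R0: "\<And>x. x \<in> K \<Longrightarrow> norm x \<le> R0"
    using compact_imp_bounded[OF K] by (auto simp: bounded_iff)
  define R where "R = max 1 R0"
  have R: "1 \<le> R" "\<And>x. x \<in> K \<Longrightarrow> norm x \<le> R"
    using R0 by (auto simp: R_def intro: le_max_iff_disj[THEN iffD2])
  obtain p D H where p: "real_polynomial_function p" "has_line_derivs p D H"
      "\<And>x v. norm x \<le> 2 * R \<Longrightarrow> 0 \<le> H x v"
    and pf: "\<And>x. norm x \<le> 2 * R \<Longrightarrow> \<bar>p x - f x\<bar> \<le> e / 3"
    using convex_on_polynomial_approx_locally_convex[OF f, of "e / 3" "2 * R"] e R(1) by auto
  obtain q where q: "real_polynomial_function q" "convex_on UNIV q"
    and qp: "\<And>x. norm x \<le> R \<Longrightarrow> \<bar>q x - p x\<bar> \<le> e / 3"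
    using locally_convex_polynomial_approx_convex[OF p R(1), of "e / 3"] e by auto
  have "\<bar>q x - f x\<bar> < e" if "x \<in> K" for x
  proof -
    have "norm x \<le> 2 * R" using R(2)[OF that] R(1) by linarith
    then show ?thesis using pf[of x] qp[OF R(2)[OF that]] e by linarith
  qed
  with q show ?thesis by (rule that)
qed

theorem corollary2p4:
  fixes \<mu> :: "((real ^ 'n) \<Rightarrow> real) \<Rightarrow> real"
  assumes "\<mu> \<in> VConv"
    and "\<And>p. p \<in> Conv \<Longrightarrow> real_polynomial_function p \<Longrightarrow> \<mu> p = 0"
  shows "\<forall>f\<in>Conv. \<mu> f = 0"
proof (intro ballI, rule ccontr)
  fix f :: "(real ^ 'n) \<Rightarrow> real"
  assume f: "f \<in> Conv" "\<mu> f \<noteq> 0"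
  have "continuous_map Conv_topology euclideanreal \<mu>"
    using assms(1) by (simp add: VConv_def)
  \<comment> \<open>The set where \<open>\<mu>\<close> is nonzero is open, so it contains a basic
    neighbourhood of \<open>f\<close>, and density places a convex polynomial there.\<close>
  then have "openin Conv_topology {g \<in> topspace Conv_topology. \<mu> g \<in> - {0}}"
    by (rule openin_continuous_map_preimage) (simp add: open_Compl)
  then obtain K e where K: "compact K" "0 < e" "Conv_nbhd K e f \<subseteq> {g \<in> Conv. \<mu> g \<noteq> 0}"
    using f by (auto simp: openin_Conv_topology)
  obtain q where q: "real_polynomial_function q" "convex_on UNIV q" "\<And>x. x \<in> K \<Longrightarrow> \<bar>q x - f x\<bar> < e"
    using convex_polynomials_dense[of f K e] f(1) K by (auto simp: Conv_def)
  then have "q \<in> Conv_nbhd K e f"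
    by (auto simp: Conv_nbhd_def Conv_def dist_real_def)
  then show False
    using K(3) assms(2)[OF _ q(1)] by auto
qed

end
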